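(* Let $X_3=\mathrm{Cay}(\mathfrak S_4,\{(1,4),(2,4),(3,4)\})$. The spectrum $\mathcal S$ of $X_3$ is given, as a multiset, by \[ \mathcal S=\left\{\pm\left|1+\exp\left(\frac{2\pi k i}{6}\right)+\exp\left(\frac{2\pi(-k+3l)i}{6}\right)\right|\ \middle|\ k\in\mathbb Z/6\mathbb Z,\ l\in\mathbb Z/2\mathbb Z\right\}, \] where $i=\sqrt{-1}$.
   Context: The spectrum of a finite graph is the multiset of eigenvalues (with multiplicity) of its adjacency matrix. The right-hand side is a multiset with 24 elements: each pair $(k,l)$ contributes two elements, one with each sign (so a value $0$ is counted twice). $\mathrm{Cay}(G,S)$ is the simple undirected graph with vertex set $G$ in which $\xi,\eta$ are adjacent iff $\eta=\xi s$ for some $s\in S$; $\mathfrak S_4$ is the symmetric group on $\{1,2,3,4\}$ and $(a,b)$ denotes a transposition. *)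

theory Defs
  imports
    "HOL-Algebra.Sym_Groups"
    "HOL-Combinatorics.Transposition"
    "Graph_Theory.Pair_Digraph"
    "Jordan_Normal_Form.Char_Poly"
begin

(* An undirected graph is represented by the symmetric set of its ordered adjacent pairs.
   The arc set below has this form when S is closed under inverses and does not contain
   the unit, see cayley_graph_pair_graph. *)
definition cayley_graph :: "('a, 'b) monoid_scheme \<Rightarrow> 'a set \<Rightarrow> 'a pair_pre_digraph" where
  "cayley_graph G S =
     \<lparr> pverts = carrier G,
       parcs = {(x, y). x \<in> carrier G \<and> y \<in> carrier G \<and> (\<exists>s\<in>S. y = x \<otimes>\<^bsub>G\<^esub> s)} \<rparr>"

definition transposition_star :: "(nat \<Rightarrow> nat) set" where
  "transposition_star = {transpose 1 4, transpose 2 4, transpose 3 4}"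

definition X3 :: "(nat \<Rightarrow> nat) pair_pre_digraph" where
  "X3 = cayley_graph (sym_group 4) transposition_star"

(* Matrices are indexed by natural numbers, so the list vs fixes an ordering of the vertices:
   it is meant to enumerate pverts G without repetition. *)
definition adjacency_matrix :: "'a pair_pre_digraph \<Rightarrow> 'a list \<Rightarrow> complex mat" where
  "adjacency_matrix G vs =
     mat (length vs) (length vs) (\<lambda>(i, j). if (vs ! i, vs ! j) \<in> parcs G then 1 else 0)"

(* Eigenvalues are counted with their multiplicity as roots of the characteristic polynomial.
   Over the complex numbers there are always length vs of them. *)
definition graph_spectrum :: "'a pair_pre_digraph \<Rightarrow> 'a list \<Rightarrow> complex multiset" where
  "graph_spectrum G vs = proots (char_poly (adjacency_matrix G vs))"

lemma cayley_graph_pair_graph: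
  fixes G (structure)
  assumes "group G" "finite (carrier G)" "S \<subseteq> carrier G" "\<one> \<notin> S"
    and inv: "\<And>s. s \<in> S \<Longrightarrow> inv s \<in> S"
  shows "pair_graph (cayley_graph G S)"
proof -
  interpret group G by fact
  have sym: "\<exists>t\<in>S. x = y \<otimes> t" if "x \<in> carrier G" "s \<in> S" "y = x \<otimes> s" for x y s
    using that assms(3) inv[OF that(2)] by (intro bexI[of _ "inv s"]) (auto simp: m_assoc)
  have loop: "x \<otimes> s \<noteq> x" if "x \<in> carrier G" "s \<in> S" for x s
  proof
    assume "x \<otimes> s = x"
    then have "s = \<one>" using that assms(3) by (metis subsetD l_cancel_one)
    with that assms(4) show False by simp
  qed
  have fin: "finite (parcs (cayley_graph G S))"
    by (rule finite_subset[of _ "carrier G \<times> carrier G"])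
       (use assms(2) in \<open>auto simp: cayley_graph_def\<close>)
  show ?thesis
  proof (unfold_locales)
    show "symmetric (with_proj (cayley_graph G S))"
      unfolding symmetric_def by (auto simp: cayley_graph_def intro!: symI dest: sym)
    show "fst e \<noteq> snd e" if "e \<in> parcs (cayley_graph G S)" for e
      using that by (auto simp: cayley_graph_def) (metis loop)
  qed (use assms(2) fin in \<open>auto simp: cayley_graph_def\<close>)
qed

lemma X3_pair_graph: "pair_graph X3"
  unfolding X3_def
proof (rule cayley_graph_pair_graph)
  have perm: "s permutes {1..4}" if "s \<in> transposition_star" for s
    using that by (auto simp: transposition_star_def intro!: permutes_swap_id)
  show "transposition_star \<subseteq> carrier (sym_group 4)"
    using perm by (auto simp: sym_group_carrier)
  show "finite (carrier (sym_group 4))"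
    by (simp add: sym_group_def finite_permutations)
  show "\<one>\<^bsub>sym_group 4\<^esub> \<notin> transposition_star"
    by (auto simp: sym_group_one transposition_star_def fun_eq_iff transpose_def)
  interpret group "sym_group 4" by (rule sym_group_is_group)
  show "inv\<^bsub>sym_group 4\<^esub> s \<in> transposition_star" if "s \<in> transposition_star" for s
  proof -
    have "s \<circ> s = id" using that by (auto simp: transposition_star_def)
    then have "inv\<^bsub>sym_group 4\<^esub> s = s"
      using perm[OF that] by (intro inv_equality) (simp_all add: sym_group_def)
    with that show ?thesis by simp
  qed
qed (rule sym_group_is_group)

end

theory Submission
  imports Defs
begin

text \<open>
  The maps \<open>x \<mapsto> p x\<close> and \<open>x \<mapsto> q x c\<close>, where \<open>p = (1 4)(2 3)\<close>, \<open>q = (1 2)(3 4)\<close> and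
  \<open>c = (1 2 3)\<close>, are commuting automorphisms of \<open>X\<^sub>3\<close> of orders 2 and 6 (right multiplication
  by \<open>c\<close> permutes the three generators), and the group they generate acts regularly on the even and
  on the odd permutations. So \<open>X\<^sub>3\<close> is a hexagonal tiling of a torus: with base points \<open>id\<close>
  and \<open>(1 4)\<close>, the even vertex at position \<open>(a, b)\<close> is adjacent to the odd vertices at
  \<open>(a, b)\<close>, \<open>(a + 1, b)\<close> and \<open>(a - 1, b + 1)\<close>. On the pair of functions that agree
  up to scalars with a character \<open>(a, b) \<mapsto> z\<^sup>a w\<^sup>b\<close> on either side, adjacency acts as
  the Hermitian matrix with zero diagonal and off-diagonal entry \<open>\<mu> = 1 + z + z\<inverse> w\<close>, hence
  with eigenvalues \<open>\<plusminus>\<bar>\<mu>\<bar>\<close>. Orthogonality of characters shows that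
  the 24 eigenfunctions form a basis.
\<close>

section \<open>Spectra from orthogonal eigenbases\<close>

lemma proots_prod_list_linear:
  "proots (\<Prod>a\<leftarrow>xs. [:- a, 1:]) = mset (xs :: 'a :: idom list)"
proof (induction xs)
  case (Cons a xs)
  have "(\<Prod>a\<leftarrow>xs. [:- a, 1:]) \<noteq> (0 :: 'a poly)"
    by (auto simp: prod_list_zero_iff)
  then have "proots ([:- a, 1:] * (\<Prod>a\<leftarrow>xs. [:- a, 1:]))
      = proots [:- a, 1:] + proots (\<Prod>a\<leftarrow>xs. [:- a, 1:])"
    by (intro proots_mult) auto
  also have "proots [:- a, 1:] = {#a#}"
    using proots_linear_factor[of "- a"] by simp
  finally show ?case
    using Cons.IH by simp
qed simp

text \<open>The eigenfunctions are the columns of \<open>P\<close>. Orthogonality with common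
  squared norm \<open>c\<close> makes the conjugate transpose divided by \<open>c\<close> an inverse
  of \<open>P\<close>, so the adjacency matrix is similar to a diagonal one. Multiplicities are
  carried by the index set \<open>J\<close>, since \<open>ev\<close> may repeat values.\<close>

lemma graph_spectrum_orthogonal_eigenbasis:
  fixes f :: "'j \<Rightarrow> 'a \<Rightarrow> complex"
  assumes "distinct vs" "finite J" "card J = length vs" "c \<noteq> 0"
    and eigen: "\<And>j x. j \<in> J \<Longrightarrow> x \<in> set vs \<Longrightarrow>
      (\<Sum>y | y \<in> set vs \<and> (x, y) \<in> parcs G. f j y) = ev j * f j x"
    and orth: "\<And>i j. i \<in> J \<Longrightarrow> j \<in> J \<Longrightarrow>
      (\<Sum>x\<in>set vs. cnj (f i x) * f j x) = (if i = j then c else 0)"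
  shows "graph_spectrum G vs = (\<Sum>j\<in>J. {#ev j#})"
proof -
  obtain js where js: "set js = J" "distinct js"
    using finite_distinct_list[OF \<open>finite J\<close>] by blast
  define n where "n = length vs"
  have n: "length vs = n" "length js = n"
    using assms(3) js distinct_card[of js] by (simp_all add: n_def)
  have sum_vs: "(\<Sum>k\<in>{0..<n}. h (vs ! k)) = (\<Sum>x\<in>set vs. h x)" for h :: "'a \<Rightarrow> complex"
    using sum.reindex_bij_betw[OF bij_betw_nth[OF assms(1) refl refl], of h]
    by (simp add: n lessThan_atLeast0)
  define A where "A = adjacency_matrix G vs"
  define P where "P = mat n n (\<lambda>(i, j). f (js ! j) (vs ! i))"
  define Q where "Q = mat n n (\<lambda>(i, j). cnj (f (js ! i) (vs ! j)) / c)"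
  define D where "D = mat n n (\<lambda>(i, j). if i = j then ev (js ! i) else 0)"
  have carr: "A \<in> carrier_mat n n" "P \<in> carrier_mat n n" "Q \<in> carrier_mat n n"
      "D \<in> carrier_mat n n"
    by (auto simp: A_def adjacency_matrix_def P_def Q_def D_def n)
  have QP: "Q * P = 1\<^sub>m n"
  proof (rule eq_matI)
    fix i j assume "i < dim_row (1\<^sub>m n :: complex mat)" "j < dim_col (1\<^sub>m n :: complex mat)"
    then have ij: "i < n" "j < n" by simp_all
    then have "(Q * P) $$ (i, j) = (\<Sum>k\<in>{0..<n}. cnj (f (js ! i) (vs ! k)) / c * f (js ! j) (vs ! k))"
      by (simp add: P_def Q_def scalar_prod_def)
    also have "\<dots> = (\<Sum>x\<in>set vs. cnj (f (js ! i) x) * f (js ! j) x) / c"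
      by (subst sum_vs[of "\<lambda>x. cnj (f (js ! i) x) / c * f (js ! j) x"])
         (simp add: sum_divide_distrib)
    also have "\<dots> = (if js ! i = js ! j then 1 else 0)"
      using ij js n \<open>c \<noteq> 0\<close> by (subst orth) auto
    finally show "(Q * P) $$ (i, j) = 1\<^sub>m n $$ (i, j)"
      using ij js n by (simp add: nth_eq_iff_index_eq)
  qed (use carr in auto)
  have PQ: "P * Q = 1\<^sub>m n"
    by (rule mat_mult_left_right_inverse[OF carr(3,2) QP])
  have AP: "A * P = P * D"
  proof (rule eq_matI)
    fix i j assume "i < dim_row (P * D)" "j < dim_col (P * D)"
    then have ij: "i < n" "j < n" using carr by auto
    let ?x = "vs ! i" and ?f = "f (js ! j)"
    have "(A * P) $$ (i, j)
        = (\<Sum>k\<in>{0..<n}. (if (?x, vs ! k) \<in> parcs G then 1 else 0) * ?f (vs ! k))"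
      using ij by (simp add: A_def adjacency_matrix_def P_def scalar_prod_def n)
    also have "\<dots> = (\<Sum>y\<in>set vs. (if (?x, y) \<in> parcs G then 1 else 0) * ?f y)"
      by (rule sum_vs)
    also have "\<dots> = (\<Sum>y | y \<in> set vs \<and> (?x, y) \<in> parcs G. ?f y)"
      by (simp add: sum.If_cases if_distrib[of "\<lambda>u. u * _"] Int_def conj_commute cong: if_cong)
    also have "\<dots> = ev (js ! j) * ?f ?x"
      using ij js n by (intro eigen) auto
    also have "\<dots> = (\<Sum>k\<in>{0..<n}. f (js ! k) ?x * (if k = j then ev (js ! k) else 0))"
      using ij by (simp add: if_distrib[of "\<lambda>u. _ * u"] sum.delta cong: if_cong)
    also have "\<dots> = (P * D) $$ (i, j)"
      using ij by (simp add: P_def D_def scalar_prod_def)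
    finally show "(A * P) $$ (i, j) = (P * D) $$ (i, j)" .
  qed (use carr in auto)
  have "A = A * (P * Q)"
    using carr by (simp add: PQ)
  also have "\<dots> = P * D * Q"
    using carr by (simp add: AP flip: assoc_mult_mat[of A n n P n Q n])
  finally have "char_poly A = char_poly D"
    using carr PQ QP by (intro char_poly_similar similar_matI[where P = P and Q = Q and n = n]) auto
  also have "\<dots> = (\<Prod>a\<leftarrow>diag_mat D. [:- a, 1:])"
    by (rule char_poly_upper_triangular[OF carr(4)]) (auto simp: D_def)
  also have "diag_mat D = map ev js"
    by (auto simp: diag_mat_def D_def n intro!: nth_equalityI)
  finally have "graph_spectrum G vs = mset (map ev js)"
    by (simp only: graph_spectrum_def A_def proots_prod_list_linear)
  also have "\<dots> = (\<Sum>j\<in>J. {#ev j#})"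
    using js by (induction js arbitrary: J) auto
  finally show ?thesis .
qed

lemma sum_powers_root_of_unity:
  fixes r :: "'a :: field"
  assumes "r ^ n = 1"
  shows "(\<Sum>a<n. r ^ a) = (if r = 1 then of_nat n else 0)"
  using assms by (simp add: sum_gp_strict)

section \<open>Torus coordinates on the permutations\<close>

definition klein_p :: "nat \<Rightarrow> nat" where "klein_p = transpose 1 4 \<circ> transpose 2 3"
definition klein_q :: "nat \<Rightarrow> nat" where "klein_q = transpose 1 2 \<circ> transpose 3 4"
definition cycle3 :: "nat \<Rightarrow> nat" where "cycle3 = transpose 1 2 \<circ> transpose 2 3"

lemma perm_relations:
  "klein_p (klein_p n) = n" "klein_q (klein_q n) = n" "cycle3 (cycle3 (cycle3 n)) = n"
  "klein_p (klein_q n) = klein_q (klein_p n)"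
  by (simp_all add: klein_p_def klein_q_def cycle3_def transpose_def)

lemma perm_permutes:
  "klein_p permutes {1..4}" "klein_q permutes {1..4}" "cycle3 permutes {1..4}"
  unfolding klein_p_def klein_q_def cycle3_def
  by (intro permutes_compose permutes_swap_id; simp)+

text \<open>Positions are pairs of natural numbers, read modulo 6 and 2; the flag \<open>e\<close> of a vertex marks
  the odd permutations. In particular \<open>a + 5\<close> and \<open>z ^ 5\<close> below stand for \<open>a - 1\<close> and \<open>z\<inverse>\<close>.\<close>

definition torus_shift :: "nat \<Rightarrow> nat \<Rightarrow> (nat \<Rightarrow> nat) \<Rightarrow> nat \<Rightarrow> nat" where
  "torus_shift a b x = ((\<circ>) klein_p ^^ b) (((\<lambda>y. klein_q \<circ> y \<circ> cycle3) ^^ a) x)"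

definition torus_vertex :: "bool \<times> nat \<times> nat \<Rightarrow> nat \<Rightarrow> nat" where
  "torus_vertex = (\<lambda>(e, a, b). torus_shift a b (if e then transpose 1 4 else id))"

definition torus_index :: "(bool \<times> nat \<times> nat) set" where
  "torus_index = UNIV \<times> {..<6} \<times> {..<2}"

lemma torus_shift_zero [simp]: "torus_shift 0 0 x = x"
  by (simp add: torus_shift_def)

lemma torus_shift_Suc_right: "torus_shift a (Suc b) x = klein_p \<circ> torus_shift a b x"
  by (simp add: torus_shift_def)

lemma torus_shift_Suc_left: "torus_shift (Suc a) b x = klein_q \<circ> torus_shift a b x \<circ> cycle3"
proof (induction b)
  case 0
  show ?case by (simp add: torus_shift_def)
next
  case (Suc b)
  then show ?case
    by (simp add: torus_shift_Suc_right fun_eq_iff perm_relations)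
qed

lemma torus_shift_add:
  "torus_shift a b (torus_shift a' b' x) = torus_shift (a + a') (b + b') x"
proof -
  have "torus_shift a 0 (torus_shift a' b' x) = torus_shift (a + a') b' x"
    by (induction a) (simp_all add: torus_shift_Suc_left)
  then show ?thesis
    by (induction b) (simp_all add: torus_shift_Suc_right)
qed

text \<open>Evaluation rules for the simplifier at concrete positions: first \<open>b\<close> is
  brought to 0, then \<open>a\<close> is lowered step by step to a base point.\<close>

lemma torus_vertex_apply:
  "torus_vertex (e, 0, 0) n = (if e then transpose 1 4 else id) n"
  "torus_vertex (e, numeral k, 0) n = klein_q (torus_vertex (e, pred_numeral k, 0) (cycle3 n))"
  "torus_vertex (e, Suc 0, 0) n = klein_q (torus_vertex (e, 0, 0) (cycle3 n))"
  "torus_vertex (e, a, Suc 0) n = klein_p (torus_vertex (e, a, 0) n)"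
  by (simp_all add: torus_vertex_def numeral_eq_Suc torus_shift_Suc_left torus_shift_Suc_right)

lemma perm_apply:
  "klein_p (Suc 0) = 4" "klein_p 2 = 3" "klein_p 3 = 2" "klein_p 4 = Suc 0"
  "klein_q (Suc 0) = 2" "klein_q 2 = Suc 0" "klein_q 3 = 4" "klein_q 4 = 3"
  "cycle3 (Suc 0) = 2" "cycle3 2 = 3" "cycle3 3 = Suc 0" "cycle3 4 = 4"
  by (simp_all add: klein_p_def klein_q_def cycle3_def transpose_def)

lemma torus_shift_mod: "torus_shift (a mod 6) (b mod 2) x = torus_shift a b x"
proof -
  \<comment> \<open>The left factor has order 2 and the right factor order 3, so the sixth iterate
    cancels both.\<close>
  have "((\<lambda>y. klein_q \<circ> y \<circ> cycle3) ^^ 6) y = y" for y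
    by (simp add: fun_eq_iff eval_nat_numeral perm_relations)
  moreover have "((\<circ>) klein_p ^^ 2) y = y" for y :: "nat \<Rightarrow> nat"
    by (simp add: fun_eq_iff eval_nat_numeral perm_relations)
  ultimately show ?thesis
    by (simp add: torus_shift_def funpow_mod_eq)
qed

lemma torus_vertex_mod: "torus_vertex (e, a mod 6, b mod 2) = torus_vertex (e, a, b)"
  by (simp add: torus_vertex_def torus_shift_mod)

lemma torus_vertex_permutes: "torus_vertex j permutes {1..4}"
proof -
  obtain e a b where j: "j = (e, a, b)" by (cases j)
  have "torus_shift 0 0 (if e then transpose 1 4 else id) permutes {1..4}"
    by (auto simp: permutes_id permutes_swap_id simp del: One_nat_def)
  then have "torus_shift a 0 (if e then transpose 1 4 else id) permutes {1..4}"
    by (induction a) (simp_all add: torus_shift_Suc_left permutes_compose perm_permutes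
          del: One_nat_def split del: if_split)
  then have "torus_shift a b (if e then transpose 1 4 else id) permutes {1..4}"
    by (induction b) (simp_all add: torus_shift_Suc_right permutes_compose perm_permutes
          del: One_nat_def split del: if_split)
  then show ?thesis by (simp add: torus_vertex_def j)
qed

lemma pverts_X3: "pverts X3 = {x. x permutes {1..4}}"
  by (simp add: X3_def cayley_graph_def sym_group_def)

lemma card_torus_index: "card torus_index = 24"
  by (simp add: torus_index_def card_cartesian_product)

lemma bij_betw_torus_vertex: "bij_betw torus_vertex torus_index (pverts X3)"
proof -
  let ?js = "List.product [False, True] (List.product [0..<6] [0..<2])"
  have index: "torus_index = set ?js"
    by (auto simp: torus_index_def)
  \<comment> \<open>Three values determine a permutation of four points, so these 24 short lists
    already separate the vertices. Surjectivity then follows by counting.\<close>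
  have "distinct (map (\<lambda>j. map (torus_vertex j) [1, 2, 3]) ?js)"
  proof -
    have "[0..<6] = [0, 1, 2, 3, 4, 5::nat]" "[0..<2] = [0, 1::nat]"
      by code_simp+
    then show ?thesis
      by (simp only: product.simps list.map append.simps)
         (simp add: torus_vertex_apply perm_apply)
  qed
  then have "inj_on (\<lambda>j. map (torus_vertex j) [1, 2, 3]) torus_index"
    unfolding index by (simp only: distinct_map)
  then have inj: "inj_on torus_vertex torus_index"
    by (auto simp: inj_on_def)
  have "torus_vertex ` torus_index = pverts X3"
  proof (rule card_subset_eq)
    show "finite (pverts X3)" by (simp add: pverts_X3 finite_permutations)
    show "torus_vertex ` torus_index \<subseteq> pverts X3"
      using torus_vertex_permutes by (auto simp: pverts_X3)
    show "card (torus_vertex ` torus_index) = card (pverts X3)"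
      using sym_group_card_carrier[of 4]
      by (simp add: card_image[OF inj] card_torus_index X3_def cayley_graph_def fact_numeral)
  qed
  with inj show ?thesis by (simp add: bij_betw_def)
qed

section \<open>Adjacency in torus coordinates\<close>

definition star_nbrs :: "(nat \<Rightarrow> nat) \<Rightarrow> (nat \<Rightarrow> nat) set" where
  "star_nbrs x = {x \<circ> transpose 1 4, x \<circ> transpose 2 4, x \<circ> transpose 3 4}"

lemma X3_nbrs:
  assumes "x \<in> pverts X3"
  shows "{y. y \<in> pverts X3 \<and> (x, y) \<in> parcs X3} = star_nbrs x"
proof -
  have "x \<circ> transpose i j \<in> pverts X3" if "i \<in> {1..4}" "j \<in> {1..4}" for i j
    using that assms by (auto simp: pverts_X3 intro!: permutes_compose permutes_swap_id)
  from this[of 1 4] this[of 2 4] this[of 3 4] assms show ?thesis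
    unfolding X3_def cayley_graph_def star_nbrs_def transposition_star_def sym_group_mult
    by (auto simp del: One_nat_def)
qed

lemma card_star_nbrs:
  assumes "x \<in> pverts X3"
  shows "card (star_nbrs x) = 3"
proof -
  have "inj x" using assms by (auto simp: pverts_X3 permutes_inj)
  then have eq: "x \<circ> f = x \<circ> g \<longleftrightarrow> f = g" for f g :: "nat \<Rightarrow> nat"
    by (auto simp: fun_eq_iff inj_def)
  \<comment> \<open>The generators are told apart by their values 1, 2, 3 at the point 4.\<close>
  have "transpose 1 4 (4::nat) \<noteq> transpose 2 4 4" "transpose 1 4 (4::nat) \<noteq> transpose 3 4 4"
    "transpose 2 4 (4::nat) \<noteq> transpose 3 4 4"
    by simp_all
  then have "transpose 1 4 \<noteq> transpose 2 (4::nat)" "transpose 1 4 \<noteq> transpose 3 (4::nat)"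
    "transpose 2 4 \<noteq> transpose 3 (4::nat)"
    by metis+
  then show ?thesis by (simp add: star_nbrs_def eq)
qed

text \<open>Left multiplications commute with right multiplication by a generator, and moving
  \<open>cycle3\<close> past the generators only permutes them cyclically. This reduces adjacency to
  the two base points.\<close>

lemma star_nbrs_shift: "star_nbrs (torus_shift a b x) = torus_shift a b ` star_nbrs x"
proof -
  have p: "star_nbrs (klein_p \<circ> x) = (\<circ>) klein_p ` star_nbrs x" for x
    by (auto simp: star_nbrs_def comp_assoc)
  have "cycle3 \<circ> transpose 1 4 = transpose 2 4 \<circ> cycle3"
    "cycle3 \<circ> transpose 2 4 = transpose 3 4 \<circ> cycle3"
    "cycle3 \<circ> transpose 3 4 = transpose 1 4 \<circ> cycle3"
    by (simp_all add: fun_eq_iff cycle3_def transpose_def)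
  then have q: "star_nbrs (klein_q \<circ> x \<circ> cycle3) = (\<lambda>y. klein_q \<circ> y \<circ> cycle3) ` star_nbrs x" for x
    by (auto simp: star_nbrs_def comp_assoc)
  have "star_nbrs (torus_shift a 0 x) = torus_shift a 0 ` star_nbrs x"
  proof (induction a)
    case (Suc a)
    then show ?case by (simp only: torus_shift_Suc_left q image_image)
  qed simp
  then show ?thesis
  proof (induction b)
    case (Suc b)
    then show ?case by (simp only: torus_shift_Suc_right p image_image)
  qed simp
qed

lemma permutes_4_eqI:
  assumes "x permutes {1..4::nat}" "y permutes {1..4}" "map x [1, 2, 3, 4] = map y [1, 2, 3, 4]"
  shows "x = y"
proof
  fix n
  have "n \<in> {1..4} \<longleftrightarrow> n \<in> {1, 2, 3, 4}" for n :: nat by auto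
  then show "x n = y n"
    using assms by (cases "n \<in> {1..4}") (auto simp: permutes_not_in)
qed

lemma star_nbrs_torus_vertex:
  "star_nbrs (torus_vertex (False, a, b))
    = {torus_vertex (True, a, b), torus_vertex (True, a + 1, b), torus_vertex (True, a + 5, b + 1)}"
  "star_nbrs (torus_vertex (True, a, b))
    = {torus_vertex (False, a, b), torus_vertex (False, a + 5, b), torus_vertex (False, a + 1, b + 1)}"
proof -
  have st: "transpose i 4 permutes {1..4::nat}" "transpose 1 4 \<circ> transpose i 4 permutes {1..4::nat}"
    if "i \<in> {1..4}" for i
    using that by (auto intro!: permutes_compose permutes_swap_id)
  \<comment> \<open>Locates the neighbours of the base points \<open>id\<close> and
    \<open>transpose 1 4\<close> on the torus; each equality is decided by the values at 1, 2, 3,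
    4.\<close>
  have "transpose 2 4 = torus_vertex (True, 1, 0)" "transpose 3 4 = torus_vertex (True, 5, 1)"
    "transpose 1 4 \<circ> transpose 2 4 = torus_vertex (False, 1, 1)"
    "transpose 1 4 \<circ> transpose 3 4 = torus_vertex (False, 5, 0)"
    by (rule permutes_4_eqI, rule st, simp, rule torus_vertex_permutes,
        simp add: torus_vertex_apply perm_apply)+
  then have base:
    "star_nbrs id = {transpose 1 4, torus_shift 1 0 (transpose 1 4), torus_shift 5 1 (transpose 1 4)}"
    "star_nbrs (transpose 1 4) = {id, torus_shift 5 0 id, torus_shift 1 1 id}"
    by (simp_all add: star_nbrs_def torus_vertex_def insert_commute)
  show "star_nbrs (torus_vertex (False, a, b))
    = {torus_vertex (True, a, b), torus_vertex (True, a + 1, b), torus_vertex (True, a + 5, b + 1)}"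
   "star_nbrs (torus_vertex (True, a, b))
    = {torus_vertex (False, a, b), torus_vertex (False, a + 5, b), torus_vertex (False, a + 1, b + 1)}"
    by (simp_all only: torus_vertex_def prod.case if_True if_False star_nbrs_shift base
      image_insert image_empty torus_shift_add add_0_right)
qed

section \<open>Eigenfunctions and their orthogonality\<close>

text \<open>A character scaled by \<open>u\<close> on even and by \<open>s\<close> on odd vertices.
  The inverse reads off reduced coordinates; off the vertex set its value is arbitrary.\<close>

definition torus_eigenfunction ::
  "complex \<Rightarrow> complex \<Rightarrow> complex \<Rightarrow> complex \<Rightarrow> (nat \<Rightarrow> nat) \<Rightarrow> complex" where
  "torus_eigenfunction z w u s x =
     (case inv_into torus_index torus_vertex x of (e, a, b) \<Rightarrow> (if e then s else u) * z ^ a * w ^ b)"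

lemma power_mod_eq:
  fixes z :: "'a :: monoid_mult"
  assumes "z ^ n = 1"
  shows "z ^ (a mod n) = z ^ a"
proof -
  have "z ^ a = z ^ (n * (a div n) + a mod n)" by simp
  also have "\<dots> = z ^ (a mod n)" by (simp only: power_add power_mult assms) simp
  finally show ?thesis by simp
qed

text \<open>The root-of-unity hypotheses make the formula valid at unreduced positions too, such as
  the neighbours at \<open>a + 5\<close> and \<open>b + 1\<close>.\<close>

lemma torus_eigenfunction_vertex:
  assumes "z ^ 6 = 1" "w ^ 2 = 1"
  shows "torus_eigenfunction z w u s (torus_vertex (e, a, b)) = (if e then s else u) * z ^ a * w ^ b"
proof -
  have "inv_into torus_index torus_vertex (torus_vertex (e, a mod 6, b mod 2)) = (e, a mod 6, b mod 2)"
    using bij_betw_torus_vertex by (intro inv_into_f_f) (auto simp: bij_betw_def torus_index_def)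
  then show ?thesis
    by (simp add: torus_eigenfunction_def torus_vertex_mod power_mod_eq assms)
qed

lemma sum_star_nbrs:
  assumes "x \<in> pverts X3" "star_nbrs x = {y1, y2, y3}"
  shows "(\<Sum>y | y \<in> pverts X3 \<and> (x, y) \<in> parcs X3. f y) = f y1 + f y2 + (f y3 :: 'a :: comm_monoid_add)"
proof -
  have "card {y1, y2, y3} = 3" using card_star_nbrs assms by metis
  then have "y1 \<noteq> y2" "y1 \<noteq> y3" "y2 \<noteq> y3"
    by (auto simp: card_insert_if split: if_splits)
  then show ?thesis by (simp add: X3_nbrs assms add_ac)
qed

lemma cnj_mult_root_of_unity:
  assumes "z ^ Suc n = 1"
  shows "z * cnj z = 1"
proof -
  have "norm z ^ Suc n = 1"
    by (simp only: assms norm_one flip: norm_power)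
  then have "norm z = 1"
    using power_eq_imp_eq_base[of "norm z" "Suc n" 1] by simp
  then show ?thesis by (simp add: complex_norm_square[symmetric])
qed

lemma cnj_root_of_unity:
  assumes "z ^ Suc n = 1"
  shows "cnj z = z ^ n"
proof -
  have "cnj z = z ^ Suc n * cnj z" by (simp only: assms) simp
  also have "\<dots> = z ^ n * (z * cnj z)" by (simp add: mult_ac)
  also have "\<dots> = z ^ n" by (simp only: cnj_mult_root_of_unity[OF assms]) simp
  finally show ?thesis .
qed

text \<open>Since \<open>cnj z\<close> is the inverse of \<open>z\<close>, the product is a quotient
  of roots of unity; it is the ratio of the geometric sums in the orthogonality relation.\<close>

lemma roots_of_unity_quotient:
  assumes "z ^ Suc n = 1" "z' ^ Suc n = 1"
  shows "(cnj z * z') ^ Suc n = 1" "cnj z * z' = 1 \<longleftrightarrow> z = z'"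
proof -
  show "(cnj z * z') ^ Suc n = 1"
    by (simp only: power_mult_distrib assms complex_cnj_power[symmetric]) simp
  show "cnj z * z' = 1 \<longleftrightarrow> z = z'"
    using cnj_mult_root_of_unity[OF assms(1)]
    by (metis mult.assoc mult.commute mult.right_neutral)
qed

text \<open>The phase \<open>u\<close> of \<open>1 + z + z\<inverse> w\<close> may be any complex unit when that number vanishes.\<close>

lemma torus_eigenfunction_eigen:
  assumes zw: "z ^ 6 = 1" "w ^ 2 = 1" and x: "x \<in> pverts X3"
    and s: "s * s = 1" and u: "cnj u * u = 1" and \<mu>: "1 + z + z ^ 5 * w = complex_of_real r * u"
  shows "(\<Sum>y | y \<in> pverts X3 \<and> (x, y) \<in> parcs X3. torus_eigenfunction z w u s y)
    = s * of_real r * torus_eigenfunction z w u s x"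
proof -
  note F = torus_eigenfunction_vertex[OF zw]
  from x bij_betw_torus_vertex obtain e a b where x_eq: "x = torus_vertex (e, a, b)"
    unfolding bij_betw_def by (metis imageE prod_cases3)
  show ?thesis
  proof (cases e)
    case False
    then have "star_nbrs x = {torus_vertex (True, a, b), torus_vertex (True, a + 1, b),
        torus_vertex (True, a + 5, b + 1)}"
      by (simp add: x_eq star_nbrs_torus_vertex)
    from sum_star_nbrs[OF x this, of "torus_eigenfunction z w u s"]
    have "(\<Sum>y | y \<in> pverts X3 \<and> (x, y) \<in> parcs X3. torus_eigenfunction z w u s y)
        = s * (1 + z + z ^ 5 * w) * (z ^ a * w ^ b)"
      unfolding F by (simp add: power_add algebra_simps)
    then show ?thesis
      unfolding x_eq F \<mu> using False by (simp add: algebra_simps)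
  next
    case True
    then have "star_nbrs x = {torus_vertex (False, a, b), torus_vertex (False, a + 5, b),
        torus_vertex (False, a + 1, b + 1)}"
      by (simp add: x_eq star_nbrs_torus_vertex)
    from sum_star_nbrs[OF x this, of "torus_eigenfunction z w u s"]
    have "(\<Sum>y | y \<in> pverts X3 \<and> (x, y) \<in> parcs X3. torus_eigenfunction z w u s y)
        = u * (1 + z ^ 5 + z * w) * (z ^ a * w ^ b)"
      unfolding F by (simp add: power_add algebra_simps)
    \<comment> \<open>Conjugation inverts \<open>z\<close> and fixes \<open>w\<close>, so the odd
      side sees the conjugate factor and its phase \<open>cnj u\<close> cancels against
      \<open>u\<close>.\<close>
    also have "1 + z ^ 5 + z * w = cnj (1 + z + z ^ 5 * w)"
    proof -
      have "cnj z = z ^ 5" "cnj w = w"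
        using zw cnj_root_of_unity[of z 5] cnj_root_of_unity[of w 1] by (simp_all add: numeral_2_eq_2)
      moreover have "(z ^ 5) ^ 5 = z"
        \<comment> \<open>25 is congruent to 1 modulo 6.\<close>
        using power_mod_eq[OF zw(1), of 25] by (simp flip: power_mult)
      ultimately show ?thesis by simp
    qed
    also have "\<dots> = of_real r * cnj u" by (simp add: \<mu>)
    finally show ?thesis
      unfolding x_eq F using True s u by (simp add: algebra_simps)
  qed
qed

text \<open>The sum factors into a scalar part and two geometric sums. Distinct characters make a
  geometric sum vanish; for equal characters the phases agree, and the scalar part
  \<open>s * s' + 1\<close> is 2 or 0, giving 2 * 6 * 2 = 24 or 0.\<close>

lemma torus_eigenfunction_orth:
  assumes zw: "z ^ 6 = 1" "w ^ 2 = 1" and zw': "z' ^ 6 = 1" "w' ^ 2 = 1"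
    and s: "s \<in> {1, -1}" "s' \<in> {1, -1}"
    and u: "cnj u * u = 1" "z = z' \<Longrightarrow> w = w' \<Longrightarrow> u = u'"
  shows "(\<Sum>x\<in>pverts X3. cnj (torus_eigenfunction z w u s x) * torus_eigenfunction z' w' u' s' x)
    = (if z = z' \<and> w = w' \<and> s = s' then 24 else 0)"
proof -
  have Z: "(cnj z * z') ^ 6 = 1" "cnj z * z' = 1 \<longleftrightarrow> z = z'"
    using roots_of_unity_quotient[of z 5 z'] zw zw' by simp_all
  have W: "(cnj w * w') ^ 2 = 1" "cnj w * w' = 1 \<longleftrightarrow> w = w'"
    using roots_of_unity_quotient[of w 1 w'] zw zw' by (simp_all add: numeral_2_eq_2)
  have "(\<Sum>x\<in>pverts X3. cnj (torus_eigenfunction z w u s x) * torus_eigenfunction z' w' u' s' x)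
    = (\<Sum>(e, a, b)\<in>torus_index. (if e then cnj s * s' else cnj u * u') *
        ((cnj z * z') ^ a * (cnj w * w') ^ b))"
    unfolding sum.reindex_bij_betw[OF bij_betw_torus_vertex, symmetric]
    by (intro sum.cong refl)
       (auto simp: torus_eigenfunction_vertex zw zw' power_mult_distrib)
  also have "\<dots> = (cnj s * s' + cnj u * u') * ((\<Sum>a<6. (cnj z * z') ^ a) * (\<Sum>b<2. (cnj w * w') ^ b))"
    unfolding torus_index_def sum_product
    by (simp add: sum.cartesian_product[symmetric] UNIV_bool sum_distrib_left ring_distribs sum.distrib)
  also have "\<dots> = (if z = z' \<and> w = w' \<and> s = s' then 24 else 0)"
    using u s Z W
    by (auto simp: sum_powers_root_of_unity)
  finally show ?thesis .
qed

section \<open>Phases and exponential roots of unity\<close>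

lemma polar_form: "\<exists>u. cnj u * u = 1 \<and> \<mu> = complex_of_real (cmod \<mu>) * u"
proof (cases "\<mu> = 0")
  case False
  then have "cnj (sgn \<mu>) * sgn \<mu> = 1"
    by (simp add: mult.commute[of "cnj _"] complex_norm_square[symmetric] norm_sgn)
  with False show ?thesis
    by (intro exI[of _ "sgn \<mu>"]) (simp add: sgn_eq)
qed (auto intro: exI[of _ 1])

lemma exp_root_of_unity:
  assumes "n > 0"
  shows "exp (2 * of_real pi * of_int k * \<i> / of_nat n) ^ n = (1 :: complex)"
proof -
  have "exp (2 * of_real pi * of_int k * \<i> / of_nat n) ^ n = exp (2 * of_real pi * of_int k * \<i>)"
    using assms by (simp flip: exp_of_nat_mult)
  also have "\<dots> = cis (2 * pi * of_int k)"
    by (simp add: cis_conv_exp mult_ac)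
  also have "\<dots> = 1" by (rule cis_multiple_2pi) simp
  finally show ?thesis .
qed

lemma inj_on_exp_root_of_unity:
  assumes "n > 0"
  shows "inj_on (\<lambda>k. exp (2 * of_real pi * of_int k * \<i> / of_nat n) :: complex) {0..<int n}"
proof (rule inj_onI)
  fix k l assume kl: "k \<in> {0..<int n}" "l \<in> {0..<int n}"
    and eq: "exp (2 * of_real pi * of_int k * \<i> / of_nat n)
      = (exp (2 * of_real pi * of_int l * \<i> / of_nat n) :: complex)"
  \<comment> \<open>Matches the form of \<open>bij_betw_roots_unity\<close>, which is indexed by
    natural numbers.\<close>
  have "exp (2 * of_real pi * of_int k * \<i> / of_nat n) = cis (2 * pi * real (nat k) / real n)"
    if "k \<ge> 0" for k using that by (simp add: cis_conv_exp mult_ac)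
  then have "cis (2 * pi * real (nat k) / real n) = cis (2 * pi * real (nat l) / real n)"
    using eq kl by simp
  moreover have "nat k \<in> {..<n}" "nat l \<in> {..<n}" using kl by auto
  ultimately have "nat k = nat l"
    using bij_betw_roots_unity[OF assms] by (auto simp: bij_betw_def dest: inj_onD)
  then show "k = l" using kl by auto
qed

theorem corollary3:
  fixes vs :: "(nat \<Rightarrow> nat) list"
  assumes "distinct vs" and "set vs = pverts X3"
  shows "graph_spectrum X3 vs =
    (\<Sum>(k, l) \<in> {0..<6::int} \<times> {0..<2::int}.
       let r = complex_of_real (cmod (1 + exp (2 * of_real pi * of_int k * \<i> / 6)
                                        + exp (2 * of_real pi * of_int (- k + 3 * l) * \<i> / 6)))
       in {# r, - r #})"
proof -
  define z where "z k = exp (2 * of_real pi * of_int k * \<i> / 6)" for k :: int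
  define w where "w l = exp (2 * of_real pi * of_int l * \<i> / 2)" for l :: int
  define \<mu> where "\<mu> k l = 1 + z k + z k ^ 5 * w l" for k l
  have z: "z k ^ 6 = 1" and w: "w l ^ 2 = 1" for k l
    using exp_root_of_unity[of 6 k] exp_root_of_unity[of 2 l] by (simp_all add: z_def w_def)
  have inj: "inj_on z {0..<6}" "inj_on w {0..<2}"
    using inj_on_exp_root_of_unity[of 6] inj_on_exp_root_of_unity[of 2]
    by (simp_all add: z_def[abs_def] w_def[abs_def])
  \<comment> \<open>Identifies the third summand of the claim: \<open>3 * l\<close> sixths of a turn
    are \<open>l\<close> halves, and multiplying by \<open>z k ^ 6 = 1\<close> replaces the exponent
    -1 by 5.\<close>
  have z_twist: "z (- k + 3 * l) = z k ^ 5 * w l" for k l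
  proof -
    let ?e = "z (- k + 3 * l)"
    have "?e * z k = w l"
      by (simp add: z_def w_def flip: exp_add) (simp add: field_simps)
    have "?e = ?e * z k ^ Suc 5"
      using z[of k] by simp
    also have "\<dots> = ?e * z k * z k ^ 5"
      by (simp only: power_Suc mult.assoc)
    also have "\<dots> = z k ^ 5 * w l"
      by (subst \<open>?e * z k = w l\<close>) (rule mult.commute)
    finally show ?thesis .
  qed
  \<comment> \<open>One phase is fixed per character and shared by both signs, as orthogonality
    requires.\<close>
  obtain u where u: "cnj (u k l) * u k l = 1" "\<mu> k l = complex_of_real (cmod (\<mu> k l)) * u k l" for k l
  proof -
    have "\<exists>u. \<forall>k l. cnj (u k l) * u k l = 1 \<and> \<mu> k l = complex_of_real (cmod (\<mu> k l)) * u k l"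
      by (intro choice allI polar_form)
    then show ?thesis using that by blast
  qed
  \<comment> \<open>The sign belongs to the index, so a vanishing \<open>\<mu> k l\<close> still
    contributes two eigenfunctions and the eigenvalue 0 twice.\<close>
  let ?J = "({0..<6::int} \<times> {0..<2::int}) \<times> {1, -1 :: complex}"
  define f where "f = (\<lambda>((k, l), s). torus_eigenfunction (z k) (w l) (u k l) s)"
  define ev where "ev = (\<lambda>((k, l), s). s * complex_of_real (cmod (\<mu> k l)))"
  have "graph_spectrum X3 vs = (\<Sum>j\<in>?J. {#ev j#})"
  proof (rule graph_spectrum_orthogonal_eigenbasis)
    show "card ?J = length vs"
      using assms bij_betw_same_card[OF bij_betw_torus_vertex] distinct_card[of vs]
      by (simp add: card_torus_index card_cartesian_product)
  next
    fix j x assume j: "j \<in> ?J" and x: "x \<in> set vs"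
    obtain k l s where "j = ((k, l), s)" by (metis surj_pair)
    with j x show "(\<Sum>y | y \<in> set vs \<and> (x, y) \<in> parcs X3. f j y) = ev j * f j x"
      using torus_eigenfunction_eigen[OF z[of k] w[of l], of x s "u k l" "cmod (\<mu> k l)"] u[of k l] assms
      by (auto simp: f_def ev_def \<mu>_def)
  next
    fix i j assume ij: "i \<in> ?J" "j \<in> ?J"
    obtain k l s where i: "i = ((k, l), s)" by (metis surj_pair)
    obtain k' l' s' where j: "j = ((k', l'), s')" by (metis surj_pair)
    have eq: "z k = z k' \<longleftrightarrow> k = k'" "w l = w l' \<longleftrightarrow> l = l'"
      using ij by (auto simp: i j inj[THEN inj_on_eq_iff])
    have "(\<Sum>x\<in>pverts X3. cnj (torus_eigenfunction (z k) (w l) (u k l) s x)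
          * torus_eigenfunction (z k') (w l') (u k' l') s' x)
        = (if z k = z k' \<and> w l = w l' \<and> s = s' then 24 else 0)"
      using ij u(1) by (intro torus_eigenfunction_orth z w) (auto simp: i j eq)
    then show "(\<Sum>x\<in>set vs. cnj (f i x) * f j x) = (if i = j then 24 else 0)"
      by (simp add: f_def i j eq assms)
  qed (use assms in auto)
  also have "\<dots> = (\<Sum>(k, l) \<in> {0..<6::int} \<times> {0..<2::int}.
      {#complex_of_real (cmod (\<mu> k l)), - complex_of_real (cmod (\<mu> k l))#})"
    by (subst sum.cartesian_product') (simp add: ev_def case_prod_unfold add_mset_commute)
  finally show ?thesis
    unfolding z_def[symmetric] z_twist \<mu>_def Let_def .
qed

end
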